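(* Let $L/\mathbb{F}_q$ be a field extension, $\Sigma\subset\mathbb{N}^*$ a finite set, $\delta_i:A\to L$ ($i\in\Sigma$) and $\gamma:A\to L$ injective $\mathbb{F}_q$-linear maps. Let $\sigma,\psi$ be two semi-characters and $m,n$ two positive integers. For all semi-characters $\alpha,\beta$ with $\alpha\beta=\sigma\psi$ and all integers $i,j\ge1$ with $i+j=m+n$ there is an element $f_{\alpha,\beta,i,j}\in\mathbb{F}_p$ (independent of $d$) such that for all $d\ge0$, $$S_d\begin{pmatrix} \sigma \\ m \end{pmatrix}S_d\begin{pmatrix} \psi \\ n \end{pmatrix}-S_d\begin{pmatrix} \sigma\psi \\ m+n \end{pmatrix}=\sum_{\substack{\alpha\beta=\sigma\psi \\ i+j=m+n}}f_{\alpha,\beta,i,j}\,S_d\begin{pmatrix} \alpha & \beta \\ i & j \end{pmatrix}.$$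
   Context: $q$ is a power of a prime $p$, $A=\mathbb{F}_q[\theta]$, $A^+$ the set of monic polynomials of $A$. Write $\gamma_a=\gamma(a)$. A semi-character is a map $A\to L$ of the form $a\mapsto\prod_{i\in\Sigma}\delta_i(a)^{\alpha_i}$ with $\alpha_i\in\mathbb{N}$; semi-characters are treated as formal monomials in the $\delta_i$, so that $\alpha\beta=\sigma\psi$ means that the exponent vectors of $\alpha$ and $\beta$ add up to that of $\sigma\psi$ (in particular the sum in the claim is finite). For semi-characters $\sigma_1,\dots,\sigma_r$, integers $n_1,\dots,n_r\ge1$ and $d\ge0$, $$S_d\begin{pmatrix} \sigma_1 & \cdots & \sigma_r \\ n_1 & \cdots & n_r \end{pmatrix}=\sum\frac{\sigma_1(a_1)\cdots\sigma_r(a_r)}{\gamma_{a_1}^{n_1}\cdots\gamma_{a_r}^{n_r}}\in L,$$ the sum being over $a_1,\dots,a_r\in A^+$ with $d=\deg_\theta(a_1)>\deg_\theta(a_2)>\cdots>\deg_\theta(a_r)\ge0$. *)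

theory Defs
  imports
    "HOL-Computational_Algebra.Computational_Algebra"
    "HOL-Library.Poly_Mapping"
begin

text \<open>
  \<open>A = F\<^sub>q[\<theta>]\<close> is \<^typ>\<open>'f poly\<close> with \<open>'f\<close> a finite field (of cardinality \<open>q\<close> and
  characteristic \<open>p\<close>). A field extension \<open>L / F\<^sub>q\<close> is a field \<open>'l\<close> together with its structure
  map \<open>\<iota> :: 'f \<Rightarrow> 'l\<close>.
\<close>

definition field_embedding :: "('f::field \<Rightarrow> 'l::field) \<Rightarrow> bool" where
  "field_embedding \<iota> \<longleftrightarrow>
     \<iota> 1 = 1 \<and> (\<forall>x y. \<iota> (x + y) = \<iota> x + \<iota> y) \<and> (\<forall>x y. \<iota> (x * y) = \<iota> x * \<iota> y)"

definition inj_Fq_linear ::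
  "('f::field \<Rightarrow> 'l::field) \<Rightarrow> ('f poly \<Rightarrow> 'l) \<Rightarrow> bool" where
  "inj_Fq_linear \<iota> g \<longleftrightarrow> Vector_Spaces.linear smult (\<lambda>c x. \<iota> c * x) g \<and> inj g"

text \<open>
  The copy \<open>{0, 1, \<dots>, p - 1}\<close> of \<open>F\<^sub>p\<close> inside a field of characteristic \<open>p > 0\<close>
  (not meaningful in characteristic zero).
\<close>

definition prime_field :: "'l::field set" where
  "prime_field = of_nat ` {..<CHAR('l)}"

text \<open>
  Semi-characters are formal monomials in the \<open>\<delta>\<^sub>i\<close>, \<open>i \<in> \<Sigma>\<close>, i.e. exponent vectors
  \<open>nat \<Rightarrow>\<^sub>0 nat\<close> supported in \<open>\<Sigma>\<close>. The product of semi-characters is the sum of exponent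
  vectors; \<open>semichar_eval\<close> is the map \<open>A \<rightarrow> L\<close> that a monomial denotes.
\<close>

definition semichars :: "nat set \<Rightarrow> (nat \<Rightarrow>\<^sub>0 nat) set" where
  "semichars \<Sigma> = {\<alpha>. Poly_Mapping.keys \<alpha> \<subseteq> \<Sigma>}"

definition semichar_eval ::
  "nat set \<Rightarrow> (nat \<Rightarrow> 'f::field poly \<Rightarrow> 'l::field) \<Rightarrow> (nat \<Rightarrow>\<^sub>0 nat) \<Rightarrow> 'f poly \<Rightarrow> 'l" where
  "semichar_eval \<Sigma> \<delta> \<alpha> a = (\<Prod>i\<in>\<Sigma>. \<delta> i a ^ Poly_Mapping.lookup \<alpha> i)"

definition semichar_factorizations ::
  "nat set \<Rightarrow> (nat \<Rightarrow>\<^sub>0 nat) \<Rightarrow> ((nat \<Rightarrow>\<^sub>0 nat) \<times> (nat \<Rightarrow>\<^sub>0 nat)) set" where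
  "semichar_factorizations \<Sigma> \<rho> =
     {(\<alpha>, \<beta>). \<alpha> \<in> semichars \<Sigma> \<and> \<beta> \<in> semichars \<Sigma> \<and> \<alpha> + \<beta> = \<rho>}"

definition exponent_splittings :: "nat \<Rightarrow> (nat \<times> nat) set" where
  "exponent_splittings N = {(i, j). 1 \<le> i \<and> 1 \<le> j \<and> i + j = N}"

text \<open>
  Tuples \<open>(a\<^sub>1, \<dots>, a\<^sub>r)\<close> of monic polynomials with
  \<open>d = deg a\<^sub>1 > deg a\<^sub>2 > \<dots> > deg a\<^sub>r\<close>, for \<open>r \<ge> 1\<close>.
\<close>

definition monic_chains :: "nat \<Rightarrow> nat \<Rightarrow> 'f::field poly list set" where
  "monic_chains r d =
     {as. length as = r \<and> as \<noteq> [] \<and> (\<forall>a\<in>set as. lead_coeff a = 1) \<and>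
          degree (hd as) = d \<and> sorted_wrt (\<lambda>a b. degree a > degree b) as}"

text \<open>
  The argument \<open>[(\<sigma>\<^sub>1, n\<^sub>1), \<dots>, (\<sigma>\<^sub>r, n\<^sub>r)]\<close> lists the columns of the array.
\<close>

definition power_sum ::
  "nat set \<Rightarrow> (nat \<Rightarrow> 'f::finite_field poly \<Rightarrow> 'l::field) \<Rightarrow> ('f poly \<Rightarrow> 'l) \<Rightarrow> nat \<Rightarrow>
   ((nat \<Rightarrow>\<^sub>0 nat) \<times> nat) list \<Rightarrow> 'l" where
  "power_sum \<Sigma> \<delta> \<gamma> d cols =
     (\<Sum>as\<in>monic_chains (length cols) d.
        (\<Prod>k<length cols. semichar_eval \<Sigma> \<delta> (fst (cols ! k)) (as ! k)) /
        (\<Prod>k<length cols. \<gamma> (as ! k) ^ snd (cols ! k)))"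

text \<open>All index sets of sums are finite, so no sum takes the default value \<open>0\<close>.\<close>

lemma finite_exponent_splittings: "finite (exponent_splittings N)"
  by (rule finite_subset[of _ "{..N} \<times> {..N}"]) (auto simp: exponent_splittings_def)

lemma finite_semichar_factorizations: "finite (semichar_factorizations \<Sigma> \<rho>)"
proof -
  let ?K = "Poly_Mapping.keys \<rho>"
  let ?B = "{f. \<forall>i. (i \<in> ?K \<longrightarrow> f i \<in> {..Max (Poly_Mapping.lookup \<rho> ` ?K)}) \<and>
    (i \<notin> ?K \<longrightarrow> f i = 0)}"
  have fin: "finite ?B"
    by (rule finite_set_of_finite_funs) auto
  have mem: "Poly_Mapping.lookup \<alpha> \<in> ?B"
    if le: "\<And>i. Poly_Mapping.lookup \<alpha> i \<le> Poly_Mapping.lookup \<rho> i" for \<alpha>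
  proof -
    have "Poly_Mapping.lookup \<alpha> i \<le> Max (Poly_Mapping.lookup \<rho> ` ?K)" if i: "i \<in> ?K" for i
    proof -
      have "Poly_Mapping.lookup \<rho> i \<le> Max (Poly_Mapping.lookup \<rho> ` ?K)"
        using i by (intro Max_ge) simp_all
      thus ?thesis using le[of i] by linarith
    qed
    moreover have "Poly_Mapping.lookup \<alpha> i = 0" if i: "i \<notin> ?K" for i
      using le[of i] i by (simp add: in_keys_iff)
    ultimately show ?thesis by simp
  qed
  let ?g = "map_prod Poly_Mapping.lookup Poly_Mapping.lookup ::
    (nat \<Rightarrow>\<^sub>0 nat) \<times> (nat \<Rightarrow>\<^sub>0 nat) \<Rightarrow> _"
  have "?g ` semichar_factorizations \<Sigma> \<rho> \<subseteq> ?B \<times> ?B"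
  proof
    fix x assume "x \<in> ?g ` semichar_factorizations \<Sigma> \<rho>"
    then obtain \<alpha> \<beta> where x: "x = (Poly_Mapping.lookup \<alpha>, Poly_Mapping.lookup \<beta>)" "\<alpha> + \<beta> = \<rho>"
      by (auto simp: semichar_factorizations_def)
    show "x \<in> ?B \<times> ?B"
      unfolding x(1)
    proof (rule SigmaI)
      show "Poly_Mapping.lookup \<alpha> \<in> ?B"
        by (rule mem) (simp add: x(2)[symmetric] lookup_add)
      show "Poly_Mapping.lookup \<beta> \<in> ?B"
        by (rule mem) (simp add: x(2)[symmetric] lookup_add)
    qed
  qed
  hence "finite (?g ` semichar_factorizations \<Sigma> \<rho>)"
    by (rule finite_subset) (intro finite_cartesian_product fin)
  moreover have "inj ?g"
    by (intro prod.inj_map) (auto intro!: injI poly_mapping_eqI)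
  ultimately show ?thesis
    by (rule finite_imageD[OF _ inj_on_subset]) simp
qed

lemma finite_monic_chains: "finite (monic_chains r d :: 'f::finite_field poly list set)"
proof -
  let ?P = "{a :: 'f poly. degree a \<le> d}"
  have "?P \<subseteq> Poly ` {xs. set xs \<subseteq> UNIV \<and> length xs \<le> Suc d}"
  proof
    fix a :: "'f poly" assume "a \<in> ?P"
    hence "length (coeffs a) \<le> Suc d" by (cases "a = 0") (auto simp: length_coeffs)
    thus "a \<in> Poly ` {xs. set xs \<subseteq> UNIV \<and> length xs \<le> Suc d}"
      by (intro image_eqI[of _ _ "coeffs a"]) auto
  qed
  hence "finite ?P"
    by (rule finite_subset) (intro finite_imageI finite_lists_length_le finite_UNIV)
  hence "finite {as. set as \<subseteq> ?P \<and> length as = r}"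
    by (rule finite_lists_length_eq)
  moreover have "monic_chains r d \<subseteq> {as. set as \<subseteq> ?P \<and> length as = r}"
  proof
    fix as :: "'f poly list" assume "as \<in> monic_chains r d"
    thus "as \<in> {as. set as \<subseteq> ?P \<and> length as = r}"
      by (cases as) (auto simp: monic_chains_def)
  qed
  ultimately show ?thesis by (rule rev_finite_subset)
qed

end

theory Submission
  imports Defs
begin

text \<open>
  The left-hand side is a sum over pairs \<open>a \<noteq> b\<close> of monic polynomials of degree \<open>d\<close>. Partial
  fractions with respect to \<open>\<gamma>\<^sub>a - \<gamma>\<^sub>b\<close> reduce the denominators \<open>\<gamma>\<^sub>a\<^sup>m \<gamma>\<^sub>b\<^sup>n\<close> to
  \<open>\<gamma>\<^sub>a\<^sup>i (\<gamma>\<^sub>a - \<gamma>\<^sub>b)\<^sup>j\<close> and, symmetrically, \<open>\<gamma>\<^sub>b\<^sup>i (\<gamma>\<^sub>b - \<gamma>\<^sub>a)\<^sup>j\<close>. For fixed \<open>a\<close>, write \<open>b = a - e c\<close>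
  with \<open>c\<close> monic of degree \<open>< d\<close> and \<open>e \<noteq> 0\<close> a scalar; expanding \<open>\<psi> (a - e c)\<close> by the binomial
  theorem separates \<open>a\<close> and \<open>c\<close>, and what remains of \<open>e\<close> is a power sum over \<open>F\<^sub>q\<^sup>*\<close>, which
  lies in the prime field.
\<close>

section \<open>Partial fractions\<close>

text \<open>Over the denominator \<open>x ^ Suc m * y ^ Suc n\<close> the two terms have numerators
  \<open>x\<close> and \<open>y\<close>. The identity trades one unit of total exponent for a factor
  \<open>x - y\<close> in the denominator.\<close>

lemma inverse_powers_step:
  fixes x y :: "'a::field"
  assumes "x \<noteq> 0" "y \<noteq> 0" "x \<noteq> y"
  shows "1 / (x ^ Suc m * y ^ Suc n) =
    (1 / (x ^ m * y ^ Suc n) - 1 / (x ^ Suc m * y ^ n)) / (x - y)"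
  using assms by (simp add: field_simps)

text \<open>The shape of an expansion of total degree \<open>N\<close>. Integer coefficients have
  images in the prime field; the index set is a parameter so that the term \<open>i = N\<close> can
  be split off.\<close>

definition pf_sum :: "nat set \<Rightarrow> nat \<Rightarrow> (nat \<Rightarrow> int) \<Rightarrow> (nat \<Rightarrow> int) \<Rightarrow> 'a::field \<Rightarrow> 'a \<Rightarrow> 'a" where
  "pf_sum I N P Q x y = (\<Sum>i\<in>I.
     of_int (P i) / (x ^ i * (x - y) ^ (N - i)) + of_int (Q i) / (y ^ i * (x - y) ^ (N - i)))"

text \<open>For \<open>i \<le> N\<close> division by \<open>x - y\<close> raises the exponent
  \<open>N - i\<close> to \<open>Suc N - i\<close>; the new top index \<open>Suc N\<close> does not
  occur.\<close>

lemma pf_sum_diff_divide: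
  fixes x y :: "'a::field"
  shows "(pf_sum {1..N} N P Q x y - pf_sum {1..N} N P' Q' x y) / (x - y) =
    pf_sum {1..<Suc N} (Suc N) (\<lambda>i. P i - P' i) (\<lambda>i. Q i - Q' i) x y"
proof -
  have shift: "u / (v * (x - y) ^ r) / (x - y) = u / (v * (x - y) ^ Suc r)" for u v and r :: nat
    by (simp only: divide_divide_eq_left power_Suc2 mult.assoc)
  show ?thesis
    unfolding pf_sum_def sum_subtractf[symmetric] sum_divide_distrib atLeastLessThanSuc_atLeastAtMost
  proof (rule sum.cong[OF refl])
    fix i assume "i \<in> {1..N}"
    then have e: "Suc N - i = Suc (N - i)" by auto
    show "(of_int (P i) / (x ^ i * (x - y) ^ (N - i)) + of_int (Q i) / (y ^ i * (x - y) ^ (N - i)) -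
        (of_int (P' i) / (x ^ i * (x - y) ^ (N - i)) + of_int (Q' i) / (y ^ i * (x - y) ^ (N - i)))) / (x - y) =
        of_int (P i - P' i) / (x ^ i * (x - y) ^ (Suc N - i)) +
        of_int (Q i - Q' i) / (y ^ i * (x - y) ^ (Suc N - i))"
      unfolding e of_int_diff diff_divide_distrib add_divide_distrib shift by (rule add_diff_add)
  qed
qed

text \<open>
  The cases \<open>m = 0\<close> and \<open>n = 0\<close>, which start the induction, need the term \<open>i = m + n\<close>; it drops
  out as soon as both exponents are positive.
\<close>

lemma partial_fractions_aux:
  assumes "m + n \<ge> 1"
  shows "\<exists>P Q. (m \<ge> 1 \<longrightarrow> n \<ge> 1 \<longrightarrow> P (m + n) = 0 \<and> Q (m + n) = 0) \<and>
    (\<forall>x y :: 'a::field. x \<noteq> 0 \<longrightarrow> y \<noteq> 0 \<longrightarrow> x \<noteq> y \<longrightarrow>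
      1 / (x ^ m * y ^ n) = pf_sum {1..m + n} (m + n) P Q x y)"
  using assms
proof (induction "m + n" arbitrary: m n rule: less_induct)
  case less
  consider "m = 0" "n \<ge> 1" | "n = 0" "m \<ge> 1" | k l where "m = Suc k" "n = Suc l"
    using less.prems by (cases m; cases n) auto
  then show ?case
  proof cases
    case 1
    then have "{1..m + n} = insert n {1..<n}" by auto
    then show ?thesis using 1
      by (intro exI[of _ "\<lambda>i. 0"] exI[of _ "\<lambda>i. if i = n then 1 else 0"])
        (simp add: pf_sum_def)
  next
    case 2
    then have "{1..m + n} = insert m {1..<m}" by auto
    then show ?thesis using 2
      by (intro exI[of _ "\<lambda>i. 0"] exI[of _ "\<lambda>i. if i = m then 1 else 0"])
        (simp add: pf_sum_def)
  next
    case 3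
    define N where "N = Suc (k + l)"
    have N: "k + Suc l = N" "Suc k + l = N" "m + n = Suc N" by (auto simp: N_def 3)
    obtain P Q where 1: "\<forall>x y :: 'a. x \<noteq> 0 \<longrightarrow> y \<noteq> 0 \<longrightarrow> x \<noteq> y \<longrightarrow>
        1 / (x ^ k * y ^ Suc l) = pf_sum {1..N} N P Q x y"
      using less.hyps[of k "Suc l", unfolded N] by (auto simp: N_def)
    obtain P' Q' where 2: "\<forall>x y :: 'a. x \<noteq> 0 \<longrightarrow> y \<noteq> 0 \<longrightarrow> x \<noteq> y \<longrightarrow>
        1 / (x ^ Suc k * y ^ l) = pf_sum {1..N} N P' Q' x y"
      using less.hyps[of "Suc k" l, unfolded N] by (auto simp: N_def)
    \<comment> \<open>The difference of the two expansions has no term at \<open>Suc N\<close>. Both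
      coefficients are set to 0 there, which allows the full range and gives the vanishing
      claim.\<close>
    define R where "R i = (if i = Suc N then 0 else P i - P' i)" for i
    define S where "S i = (if i = Suc N then 0 else Q i - Q' i)" for i
    have "1 / (x ^ m * y ^ n) = pf_sum {1..m + n} (m + n) R S x y"
      if xy: "x \<noteq> 0" "y \<noteq> 0" "x \<noteq> y" for x y :: 'a
    proof -
      have s: "{1..Suc N} = insert (Suc N) {1..<Suc N}" by auto
      have "1 / (x ^ m * y ^ n) = (pf_sum {1..N} N P Q x y - pf_sum {1..N} N P' Q' x y) / (x - y)"
        using 1 2 xy by (simp only: 3 inverse_powers_step[OF xy] simp_thms)
      also have "\<dots> = pf_sum {1..<Suc N} (Suc N) R S x y"
        unfolding pf_sum_diff_divide by (simp add: pf_sum_def R_def S_def)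
      also have "\<dots> = pf_sum {1..m + n} (m + n) R S x y"
        unfolding N(3) s by (simp add: pf_sum_def R_def S_def)
      finally show ?thesis .
    qed
    then show ?thesis
      by (intro exI[of _ R] exI[of _ S]) (simp add: R_def S_def N(3))
  qed
qed

lemma sum_exponent_splittings:
  "(\<Sum>(i, j)\<in>exponent_splittings N. g i j) = (\<Sum>i\<in>{1..<N}. g i (N - i))"
  by (rule sum.reindex_bij_witness[of _ "\<lambda>i. (i, N - i)" fst]) (auto simp: exponent_splittings_def)

text \<open>The terms with \<open>i = m + n\<close> vanish, so only exponents
  \<open>i, j \<ge> 1\<close> remain. The integers are fixed before \<open>x\<close> and
  \<open>y\<close>, which is why the final coefficients are independent of \<open>d\<close>.\<close>

lemma partial_fractions:
  assumes "m \<ge> 1" "n \<ge> 1"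
  obtains P Q :: "nat \<Rightarrow> int" where
    "\<And>x y :: 'a::field. x \<noteq> 0 \<Longrightarrow> y \<noteq> 0 \<Longrightarrow> x \<noteq> y \<Longrightarrow>
      1 / (x ^ m * y ^ n) = (\<Sum>(i, j)\<in>exponent_splittings (m + n).
        of_int (P i) / (x ^ i * (x - y) ^ j) + of_int (Q i) / (y ^ i * (x - y) ^ j))"
proof -
  obtain P Q where 0: "P (m + n) = 0" "Q (m + n) = 0"
    and PQ: "\<And>x y :: 'a. x \<noteq> 0 \<Longrightarrow> y \<noteq> 0 \<Longrightarrow> x \<noteq> y \<Longrightarrow>
      1 / (x ^ m * y ^ n) = pf_sum {1..m + n} (m + n) P Q x y"
    using partial_fractions_aux[of m n, where ?'a = 'a] assms by auto
  have s: "{1..m + n} = insert (m + n) {1..<m + n}" using assms by auto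
  show thesis
  proof (rule that[of P Q])
    fix x y :: 'a assume "x \<noteq> 0" "y \<noteq> 0" "x \<noteq> y"
    from PQ[OF this] show "1 / (x ^ m * y ^ n) = (\<Sum>(i, j)\<in>exponent_splittings (m + n).
        of_int (P i) / (x ^ i * (x - y) ^ j) + of_int (Q i) / (y ^ i * (x - y) ^ j))"
      unfolding sum_exponent_splittings s pf_sum_def by (simp add: 0)
  qed
qed

section \<open>The prime field\<close>

text \<open>In positive characteristic every integer has the same image as its least nonnegative
  residue. As the image of a ring homomorphism the set is closed under sums and products.\<close>

lemma prime_field_eq_range_of_int:
  assumes "CHAR('l::field) > 0"
  shows "(prime_field :: 'l set) = range of_int"
proof
  show "(prime_field :: 'l set) \<subseteq> range of_int"
    by (auto simp: prime_field_def) (metis of_int_of_nat_eq rangeI)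
  show "range of_int \<subseteq> (prime_field :: 'l set)"
  proof
    fix z :: 'l assume "z \<in> range of_int"
    then obtain k where k: "z = of_int k" by blast
    define r where "r = nat (k mod int CHAR('l))"
    have "r < CHAR('l)" and r: "int r = k mod int CHAR('l)"
      using assms by (auto simp: r_def nat_less_iff)
    moreover have "z = of_nat r"
    proof -
      have "z = of_int (int CHAR('l) * (k div int CHAR('l)) + k mod int CHAR('l))"
        by (simp add: k)
      also have "\<dots> = of_int (int r)"
        unfolding of_int_add of_int_mult r by simp
      finally show ?thesis by simp
    qed
    ultimately show "z \<in> prime_field" unfolding prime_field_def by auto
  qed
qed

lemma
  assumes "CHAR('l::field) > 0"
  shows of_int_in_prime_field: "(of_int k :: 'l) \<in> prime_field"
    and prime_field_add: "\<And>x y :: 'l. x \<in> prime_field \<Longrightarrow> y \<in> prime_field \<Longrightarrow> x + y \<in> prime_field"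
    and prime_field_mult: "\<And>x y :: 'l. x \<in> prime_field \<Longrightarrow> y \<in> prime_field \<Longrightarrow> x * y \<in> prime_field"
  unfolding prime_field_eq_range_of_int[OF assms]
  by (auto simp flip: of_int_add of_int_mult)

section \<open>Field embeddings\<close>

lemma
  fixes \<iota> :: "'f::field \<Rightarrow> 'l::field"
  assumes "field_embedding \<iota>"
  shows field_embedding_1: "\<iota> 1 = 1"
    and field_embedding_add: "\<iota> (x + y) = \<iota> x + \<iota> y"
    and field_embedding_mult: "\<iota> (x * y) = \<iota> x * \<iota> y"
  using assms unfolding field_embedding_def by auto

lemma field_embedding_0:
  assumes "field_embedding \<iota>"
  shows "\<iota> 0 = 0"
  using field_embedding_add[OF assms, of 0 0] by (metis add_0_right add_cancel_right_right)

lemma field_embedding_minus: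
  assumes "field_embedding \<iota>"
  shows "\<iota> (- x) = - \<iota> x"
  using field_embedding_add[OF assms, of "- x" x]
  by (simp add: field_embedding_0[OF assms] eq_neg_iff_add_eq_0)

lemma field_embedding_nonzero:
  assumes "field_embedding \<iota>" "x \<noteq> 0"
  shows "\<iota> x \<noteq> 0"
  using field_embedding_mult[OF assms(1), of x "inverse x"] assms(2)
  by (auto simp: field_embedding_1[OF assms(1)])

lemma field_embedding_of_nat:
  assumes "field_embedding \<iota>"
  shows "\<iota> (of_nat k) = of_nat k"
  by (induction k) (simp_all add: field_embedding_0[OF assms] field_embedding_1[OF assms]
      field_embedding_add[OF assms])

text \<open>The characteristic of the finite field is positive and is sent to 0 by
  \<open>\<iota>\<close>. Positivity in \<open>'l\<close> is what makes \<open>prime_field\<close>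
  meaningful.\<close>

lemma field_embedding_CHAR_pos:
  fixes \<iota> :: "'f::finite_field \<Rightarrow> 'l::field"
  assumes "field_embedding \<iota>"
  shows "CHAR('l) > 0"
proof -
  have "CHAR('f) > 0" by (rule finite_imp_CHAR_pos) simp
  moreover have "of_nat CHAR('f) = (0 :: 'l)"
    using field_embedding_of_nat[OF assms, of "CHAR('f)"] by (simp add: field_embedding_0[OF assms])
  ultimately show ?thesis
    by (metis CHAR_pos_iff)
qed

text \<open>For \<open>b = a - e c\<close>, \<open>\<iota> (- e) ^ k\<close> is the factor pulled
  out of a monomial of degree \<open>k\<close> at \<open>- e c\<close>, and
  \<open>\<iota> e ^ j\<close> the one pulled out of
  \<open>(\<gamma> a - \<gamma> b) ^ j\<close>.\<close>

definition unit_power_sum :: "('f::finite_field \<Rightarrow> 'l::field) \<Rightarrow> nat \<Rightarrow> nat \<Rightarrow> 'l" where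
  "unit_power_sum \<iota> k j = (\<Sum>e\<in>UNIV - {0}. \<iota> (- e) ^ k / \<iota> e ^ j)"

text \<open>
  Substituting \<open>g e\<close> for \<open>e\<close> shows that the sum vanishes unless \<open>g\<^sup>k = g\<^sup>j\<close> for all \<open>g \<noteq> 0\<close>, in
  which case its terms all equal \<open>(-1)\<^sup>k\<close>.
\<close>

lemma unit_power_sum_in_prime_field:
  fixes \<iota> :: "'f::finite_field \<Rightarrow> 'l::field"
  assumes emb: "field_embedding \<iota>"
  shows "unit_power_sum \<iota> k j \<in> prime_field"
proof -
  note simps = field_embedding_mult[OF emb] field_embedding_minus[OF emb]
  note nz = field_embedding_nonzero[OF emb]
  have scale: "unit_power_sum \<iota> k j = \<iota> g ^ k / \<iota> g ^ j * unit_power_sum \<iota> k j" if g: "g \<noteq> 0" for g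
  proof -
    have "unit_power_sum \<iota> k j = (\<Sum>e\<in>UNIV - {0}. \<iota> (- (g * e)) ^ k / \<iota> (g * e) ^ j)"
      unfolding unit_power_sum_def
      by (rule sum.reindex_bij_witness[of _ "\<lambda>e. g * e" "\<lambda>e. e / g"]) (use g in auto)
    also have "\<dots> = \<iota> g ^ k / \<iota> g ^ j * unit_power_sum \<iota> k j"
      unfolding unit_power_sum_def sum_distrib_left
      by (intro sum.cong refl)
        (simp add: simps power_mult_distrib flip: mult_minus_right)
    finally show ?thesis .
  qed
  show ?thesis
  proof (cases "unit_power_sum \<iota> k j = 0")
    case True
    then show ?thesis
      using of_int_in_prime_field[OF field_embedding_CHAR_pos[OF emb], of 0] by simp
  next
    case False
    have "\<iota> g ^ k = \<iota> g ^ j" if "g \<noteq> 0" for g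
      using scale[OF that] False nz[OF that] by (simp add: field_simps)
    then have "\<iota> (- e) ^ k / \<iota> e ^ j = (- 1) ^ k" if "e \<noteq> 0" for e
      using that nz[OF that] by (simp add: simps power_minus[of "\<iota> e"])
    then have "unit_power_sum \<iota> k j = of_int (int (card (UNIV - {0 :: 'f})) * (- 1) ^ k)"
      unfolding unit_power_sum_def by simp
    then show ?thesis
      using of_int_in_prime_field[OF field_embedding_CHAR_pos[OF emb]] by metis
  qed
qed

text \<open>Injectivity keeps \<open>\<gamma> a\<close> and \<open>\<gamma> a - \<gamma> b\<close>
  nonzero for \<open>a \<noteq> 0\<close> and \<open>a \<noteq> b\<close>, so that the partial
  fractions apply to them.\<close>

lemma
  assumes "inj_Fq_linear \<iota> g"
  shows inj_Fq_linear_diff: "g (a - b) = g a - g b"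
    and inj_Fq_linear_smult: "g (smult c a) = \<iota> c * g a"
    and inj_Fq_linear_eq_iff: "g a = g b \<longleftrightarrow> a = b"
    and inj_Fq_linear_nonzero: "a \<noteq> 0 \<Longrightarrow> g a \<noteq> 0"
proof -
  interpret Vector_Spaces.linear smult "\<lambda>c x. \<iota> c * x" g
    using assms unfolding inj_Fq_linear_def by blast
  show "g (a - b) = g a - g b" by (rule diff)
  show "g (smult c a) = \<iota> c * g a" by (rule scale)
  show iff: "g a = g b \<longleftrightarrow> a = b" for a b
    using assms unfolding inj_Fq_linear_def by (auto dest: injD)
  show "a \<noteq> 0 \<Longrightarrow> g a \<noteq> 0"
    using iff[of a 0] zero by simp
qed

section \<open>Sums over monic polynomials\<close>

definition monic_deg :: "nat \<Rightarrow> 'f::field poly set" where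
  "monic_deg d = {a. lead_coeff a = 1 \<and> degree a = d}"

definition monic_below :: "nat \<Rightarrow> 'f::field poly set" where
  "monic_below d = {a. lead_coeff a = 1 \<and> degree a < d}"

lemma monic_chains_1: "monic_chains 1 d = (\<lambda>a. [a]) ` monic_deg d"
  by (auto simp: monic_chains_def monic_deg_def length_Suc_conv image_iff)

lemma monic_chains_2: "monic_chains 2 d = (\<lambda>(a, c). [a, c]) ` (monic_deg d \<times> monic_below d)"
  by (auto simp: monic_chains_def monic_deg_def monic_below_def length_Suc_conv image_iff
      numeral_2_eq_2)

lemma finite_monic_deg: "finite (monic_deg d :: 'f::finite_field poly set)"
  using finite_monic_chains[of 1 d, where ?'f = 'f] unfolding monic_chains_1
  by (rule finite_imageD) (auto intro: inj_onI)

lemma power_sum_single: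
  "power_sum \<Sigma> \<delta> \<gamma> d [(\<sigma>, m)] = (\<Sum>a\<in>monic_deg d. semichar_eval \<Sigma> \<delta> \<sigma> a / \<gamma> a ^ m)"
  by (simp add: power_sum_def monic_chains_1[simplified] sum.reindex inj_on_def)

lemma power_sum_pair:
  "power_sum \<Sigma> \<delta> \<gamma> d [(\<alpha>, i), (\<beta>, j)] = (\<Sum>a\<in>monic_deg d. \<Sum>c\<in>monic_below d.
    semichar_eval \<Sigma> \<delta> \<alpha> a * semichar_eval \<Sigma> \<delta> \<beta> c / (\<gamma> a ^ i * \<gamma> c ^ j))"
proof -
  have "length [(\<alpha>, i), (\<beta>, j)] = 2" by simp
  moreover have "{..<2::nat} = {0, 1}" by auto
  ultimately show ?thesis
    unfolding power_sum_def by (simp add: monic_chains_2[unfolded numeral_2_eq_2] sum.reindex inj_on_def sum.cartesian_product case_prod_unfold)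
qed

text \<open>For monic \<open>a \<noteq> b\<close> of degree \<open>d\<close> the leading terms
  cancel, so \<open>a - b\<close> is nonzero of degree below \<open>d\<close> and factors uniquely
  as its leading coefficient \<open>e\<close> times a monic \<open>c\<close>. Conversely,
  subtracting \<open>e c\<close> leaves the leading term of \<open>a\<close> intact.\<close>

lemma sum_monic_deg_diff:
  fixes a :: "'f::finite_field poly"
  assumes a: "a \<in> monic_deg d"
  shows "(\<Sum>b\<in>monic_deg d - {a}. F b) =
    (\<Sum>c\<in>monic_below d. \<Sum>e\<in>UNIV - {0}. F (a - smult e c))"
proof -
  have "(\<Sum>b\<in>monic_deg d - {a}. F b) =
      (\<Sum>(c, e)\<in>monic_below d \<times> (UNIV - {0}). F (a - smult e c))"
  proof (rule sum.reindex_bij_witness[of _ "\<lambda>(c, e). a - smult e c"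
        "\<lambda>b. (smult (inverse (lead_coeff (a - b))) (a - b), lead_coeff (a - b))"])
    fix b assume b: "b \<in> monic_deg d - {a}"
    have lc: "lead_coeff (a - b) \<noteq> 0" unfolding leading_coeff_0_iff using b by auto
    have lt: "degree (a - b) < d"
    proof -
      have "degree (a - b) \<le> d" using a b by (intro degree_diff_le) (auto simp: monic_deg_def)
      moreover have "coeff (a - b) d = 0" using a b by (auto simp: monic_deg_def)
      ultimately show ?thesis using lc by (metis le_neq_implies_less)
    qed
    show "(smult (inverse (lead_coeff (a - b))) (a - b), lead_coeff (a - b))
        \<in> monic_below d \<times> (UNIV - {0})"
      using b lt by (auto simp: monic_below_def simp del: coeff_diff)
    show "(case (smult (inverse (lead_coeff (a - b))) (a - b), lead_coeff (a - b)) of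
        (c, e) \<Rightarrow> a - smult e c) = b"
      using lc by (simp del: coeff_diff)
    show "(case (smult (inverse (lead_coeff (a - b))) (a - b), lead_coeff (a - b)) of
        (c, e) \<Rightarrow> F (a - smult e c)) = F b"
      using lc by (simp del: coeff_diff)
  next
    fix ce :: "'f poly \<times> 'f" assume "ce \<in> monic_below d \<times> (UNIV - {0})"
    then obtain c e where ce: "ce = (c, e)" "lead_coeff c = 1" "degree c < d" "e \<noteq> 0"
      by (auto simp: monic_below_def)
    show "(case ce of (c, e) \<Rightarrow> a - smult e c) \<in> monic_deg d - {a}"
    proof -
      have "degree (smult e c) < degree a" using a ce by (auto simp: monic_deg_def)
      then have "degree (a - smult e c) = degree a"
        using degree_add_eq_left[of "- smult e c" a] by simp
      moreover have "coeff c d = 0" using ce by (simp add: coeff_eq_0)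
      moreover have "smult e c \<noteq> 0" using ce by auto
      ultimately show ?thesis using a by (auto simp: ce(1) monic_deg_def)
    qed
    show "(smult (inverse (lead_coeff (a - (case ce of (c, e) \<Rightarrow> a - smult e c))))
          (a - (case ce of (c, e) \<Rightarrow> a - smult e c)),
        lead_coeff (a - (case ce of (c, e) \<Rightarrow> a - smult e c))) = ce"
      using ce by simp
  qed
  then show ?thesis by (simp add: sum.cartesian_product)
qed

section \<open>Binomial expansion of semi-characters\<close>

text \<open>
  The sum runs up to \<open>s + k\<close>, where the extra binomial coefficients vanish, in order to match a
  sum over all factorizations of \<open>\<sigma> + \<psi>\<close>.
\<close>

lemma binomial_shifted:
  fixes x y :: "'a::comm_semiring_1"
  shows "x ^ s * (x + y) ^ k = (\<Sum>j\<le>s + k. of_nat (k choose j) * x ^ (s + k - j) * y ^ j)"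
proof -
  have "x ^ s * (x + y) ^ k = (\<Sum>j\<le>k. of_nat (k choose j) * x ^ (s + k - j) * y ^ j)"
    unfolding add.commute[of x y] binomial_ring sum_distrib_left
  proof (intro sum.cong refl)
    fix j assume "j \<in> {..k}"
    then have "x ^ (s + k - j) = x ^ s * x ^ (k - j)" by (simp flip: power_add)
    then show "x ^ s * (of_nat (k choose j) * y ^ j * x ^ (k - j)) =
        of_nat (k choose j) * x ^ (s + k - j) * y ^ j"
      by (simp add: mult_ac)
  qed
  also have "\<dots> = (\<Sum>j\<le>s + k. of_nat (k choose j) * x ^ (s + k - j) * y ^ j)"
    by (rule sum.mono_neutral_left) (auto simp: not_le binomial_eq_0)
  finally show ?thesis .
qed

text \<open>Expand each factor by \<open>binomial_shifted\<close> and multiply out. A choice of one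
  index per factor is an exponent vector \<open>\<beta>\<close> bounded by
  \<open>\<sigma> + \<psi>\<close>, and \<open>\<alpha>\<close> is its complement.\<close>

lemma prod_shifted_binomials:
  fixes x y :: "nat \<Rightarrow> 'a::comm_semiring_1"
  assumes \<Sigma>: "finite \<Sigma>" and \<sigma>: "\<sigma> \<in> semichars \<Sigma>" and \<psi>: "\<psi> \<in> semichars \<Sigma>"
  defines "l \<equiv> Poly_Mapping.lookup"
  shows "(\<Prod>i\<in>\<Sigma>. x i ^ l \<sigma> i * (x i + y i) ^ l \<psi> i) =
    (\<Sum>(\<alpha>, \<beta>)\<in>semichar_factorizations \<Sigma> (\<sigma> + \<psi>).
      \<Prod>i\<in>\<Sigma>. of_nat (l \<psi> i choose l \<beta> i) * x i ^ l \<alpha> i * y i ^ l \<beta> i)"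
proof -
  let ?\<rho> = "\<sigma> + \<psi>"
  let ?t = "\<lambda>i j. of_nat (l \<psi> i choose j) * x i ^ (l ?\<rho> i - j) * y i ^ j"
  have out: "l \<sigma> i = 0" "l \<psi> i = 0" if "i \<notin> \<Sigma>" for i
    using \<sigma> \<psi> that by (auto simp: semichars_def l_def in_keys_iff subset_iff)
  have l_add: "l (\<alpha> + \<beta>) i = l \<alpha> i + l \<beta> i" for \<alpha> \<beta> i
    by (simp add: l_def lookup_add)
  have l_diff: "l (\<alpha> - \<beta>) i = l \<alpha> i - l \<beta> i" for \<alpha> \<beta> i
    by (simp add: l_def lookup_minus)
  have l_ext: "\<alpha> = \<beta>" if "\<And>i. l \<alpha> i = l \<beta> i" for \<alpha> \<beta>
    using that by (auto simp: l_def intro: poly_mapping_eqI)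
  have in_semichars: "\<alpha> \<in> semichars \<Sigma> \<longleftrightarrow> (\<forall>i. i \<notin> \<Sigma> \<longrightarrow> l \<alpha> i = 0)" for \<alpha>
    by (auto simp: semichars_def l_def in_keys_iff)
  define mk where "mk g = Abs_poly_mapping (\<lambda>i. if i \<in> \<Sigma> then g i else 0)" for g :: "nat \<Rightarrow> nat"
  have l_mk: "l (mk g) i = (if i \<in> \<Sigma> then g i else 0)" for g i
    unfolding l_def mk_def by (subst lookup_Abs_poly_mapping) (use \<Sigma> in auto)
  have "(\<Prod>i\<in>\<Sigma>. x i ^ l \<sigma> i * (x i + y i) ^ l \<psi> i) = (\<Prod>i\<in>\<Sigma>. \<Sum>j\<le>l ?\<rho> i. ?t i j)"
    by (rule prod.cong) (simp_all only: binomial_shifted l_add)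
  also have "\<dots> = (\<Sum>g\<in>Pi\<^sub>E \<Sigma> (\<lambda>i. {..l ?\<rho> i}). \<Prod>i\<in>\<Sigma>. ?t i (g i))"
    using \<Sigma> by (intro prod_sum_PiE) auto
  also have "\<dots> = (\<Sum>(\<alpha>, \<beta>)\<in>semichar_factorizations \<Sigma> ?\<rho>.
      \<Prod>i\<in>\<Sigma>. of_nat (l \<psi> i choose l \<beta> i) * x i ^ l \<alpha> i * y i ^ l \<beta> i)"
  \<comment> \<open>Choice functions in \<open>Pi\<^sub>E\<close> are \<open>undefined\<close>
    outside \<open>\<Sigma>\<close>, while exponent vectors of semi-characters are 0 there; hence
    \<open>restrict\<close> in one direction and \<open>mk\<close> in the other.\<close>
  proof (rule sum.reindex_bij_witness[of _ "\<lambda>(\<alpha>, \<beta>). restrict (l \<beta>) \<Sigma>" "\<lambda>g. (?\<rho> - mk g, mk g)"])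
    fix g assume g: "g \<in> Pi\<^sub>E \<Sigma> (\<lambda>i. {..l ?\<rho> i})"
    then have le: "g i \<le> l ?\<rho> i" if "i \<in> \<Sigma>" for i using that by auto
    show "(case (?\<rho> - mk g, mk g) of (\<alpha>, \<beta>) \<Rightarrow> restrict (l \<beta>) \<Sigma>) = g"
      using g by (auto simp: l_mk fun_eq_iff PiE_def extensional_def)
    show "(?\<rho> - mk g, mk g) \<in> semichar_factorizations \<Sigma> ?\<rho>"
      using le by (auto simp: semichar_factorizations_def in_semichars l_mk l_diff l_add out intro!: l_ext)
    show "(case (?\<rho> - mk g, mk g) of (\<alpha>, \<beta>) \<Rightarrow>
        \<Prod>i\<in>\<Sigma>. of_nat (l \<psi> i choose l \<beta> i) * x i ^ l \<alpha> i * y i ^ l \<beta> i) = (\<Prod>i\<in>\<Sigma>. ?t i (g i))"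
      by (simp add: l_mk l_diff)
  next
    fix p assume p: "p \<in> semichar_factorizations \<Sigma> ?\<rho>"
    obtain \<alpha> \<beta> where ab: "p = (\<alpha>, \<beta>)" by (cases p)
    from p have *: "\<alpha> \<in> semichars \<Sigma>" "\<beta> \<in> semichars \<Sigma>" "\<alpha> + \<beta> = ?\<rho>"
      by (auto simp: ab semichar_factorizations_def)
    have sum: "l ?\<rho> i = l \<alpha> i + l \<beta> i" for i
      unfolding *(3)[symmetric] by (rule l_add)
    have mk: "mk (restrict (l \<beta>) \<Sigma>) = \<beta>"
      using *(2) by (intro l_ext) (auto simp: l_mk in_semichars)
    show "(case p of (\<alpha>, \<beta>) \<Rightarrow> restrict (l \<beta>) \<Sigma>) \<in> Pi\<^sub>E \<Sigma> (\<lambda>i. {..l ?\<rho> i})"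
      by (auto simp: ab sum)
    show "(?\<rho> - mk (case p of (\<alpha>, \<beta>) \<Rightarrow> restrict (l \<beta>) \<Sigma>),
        mk (case p of (\<alpha>, \<beta>) \<Rightarrow> restrict (l \<beta>) \<Sigma>)) = p"
      by (simp add: ab mk flip: *(3))
  qed
  finally show ?thesis .
qed

lemma semichar_eval_add:
  "semichar_eval \<Sigma> \<delta> (\<alpha> + \<beta>) a = semichar_eval \<Sigma> \<delta> \<alpha> a * semichar_eval \<Sigma> \<delta> \<beta> a"
  by (simp add: semichar_eval_def lookup_add power_add prod.distrib)

text \<open>The multi-index binomial coefficient. For finite \<open>\<Sigma>\<close> it is 0 as soon
  as \<open>\<beta>\<close> exceeds \<open>\<psi>\<close> at some index of \<open>\<Sigma>\<close>,
  so those factorizations contribute nothing.\<close>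

definition semichar_binomial :: "nat set \<Rightarrow> (nat \<Rightarrow>\<^sub>0 nat) \<Rightarrow> (nat \<Rightarrow>\<^sub>0 nat) \<Rightarrow> nat" where
  "semichar_binomial \<Sigma> \<psi> \<beta> = (\<Prod>i\<in>\<Sigma>. Poly_Mapping.lookup \<psi> i choose Poly_Mapping.lookup \<beta> i)"

definition semichar_degree :: "nat set \<Rightarrow> (nat \<Rightarrow>\<^sub>0 nat) \<Rightarrow> nat" where
  "semichar_degree \<Sigma> \<beta> = (\<Sum>i\<in>\<Sigma>. Poly_Mapping.lookup \<beta> i)"

text \<open>By linearity \<open>\<delta> i\<close> takes the value
  \<open>\<delta> i a + \<iota> (- e) * \<delta> i c\<close> at \<open>a - e c\<close>. After the
  binomial expansion the powers of \<open>\<iota> (- e)\<close> over all \<open>i\<close> combine to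
  the total degree of \<open>\<beta>\<close>.\<close>

lemma semichar_eval_diff_smult:
  assumes emb: "field_embedding \<iota>" and \<Sigma>: "finite \<Sigma>"
    and \<delta>: "\<And>i. i \<in> \<Sigma> \<Longrightarrow> inj_Fq_linear \<iota> (\<delta> i)"
    and \<sigma>: "\<sigma> \<in> semichars \<Sigma>" and \<psi>: "\<psi> \<in> semichars \<Sigma>"
  shows "semichar_eval \<Sigma> \<delta> \<sigma> a * semichar_eval \<Sigma> \<delta> \<psi> (a - smult e c) =
    (\<Sum>(\<alpha>, \<beta>)\<in>semichar_factorizations \<Sigma> (\<sigma> + \<psi>).
      of_nat (semichar_binomial \<Sigma> \<psi> \<beta>) * \<iota> (- e) ^ semichar_degree \<Sigma> \<beta> *
      semichar_eval \<Sigma> \<delta> \<alpha> a * semichar_eval \<Sigma> \<delta> \<beta> c)"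
proof -
  let ?l = Poly_Mapping.lookup
  have "semichar_eval \<Sigma> \<delta> \<sigma> a * semichar_eval \<Sigma> \<delta> \<psi> (a - smult e c) =
      (\<Prod>i\<in>\<Sigma>. \<delta> i a ^ ?l \<sigma> i * (\<delta> i a + \<iota> (- e) * \<delta> i c) ^ ?l \<psi> i)"
    unfolding semichar_eval_def prod.distrib[symmetric]
    by (rule prod.cong)
      (simp_all add: inj_Fq_linear_diff[OF \<delta>] inj_Fq_linear_smult[OF \<delta>] field_embedding_minus[OF emb])
  also have "\<dots> = (\<Sum>(\<alpha>, \<beta>)\<in>semichar_factorizations \<Sigma> (\<sigma> + \<psi>).
      \<Prod>i\<in>\<Sigma>. of_nat (?l \<psi> i choose ?l \<beta> i) * \<delta> i a ^ ?l \<alpha> i * (\<iota> (- e) * \<delta> i c) ^ ?l \<beta> i)"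
    by (rule prod_shifted_binomials[OF \<Sigma> \<sigma> \<psi>])
  also have "\<dots> = (\<Sum>(\<alpha>, \<beta>)\<in>semichar_factorizations \<Sigma> (\<sigma> + \<psi>).
      of_nat (semichar_binomial \<Sigma> \<psi> \<beta>) * \<iota> (- e) ^ semichar_degree \<Sigma> \<beta> *
      semichar_eval \<Sigma> \<delta> \<alpha> a * semichar_eval \<Sigma> \<delta> \<beta> c)"
    by (intro sum.cong refl)
      (auto simp: semichar_eval_def semichar_binomial_def semichar_degree_def prod.distrib
        power_mult_distrib power_sum mult_ac)
  finally show ?thesis .
qed

section \<open>Sums over pairs of distinct monic polynomials\<close>

text \<open>What is left after summation over \<open>e\<close>, where \<open>\<psi>\<close> is the
  semi-character being expanded. Neither \<open>d\<close> nor \<open>\<alpha>\<close>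
  enters.\<close>

definition pair_coeff ::
  "('f::finite_field \<Rightarrow> 'l::field) \<Rightarrow> nat set \<Rightarrow> (nat \<Rightarrow>\<^sub>0 nat) \<Rightarrow> (nat \<Rightarrow>\<^sub>0 nat) \<Rightarrow> nat \<Rightarrow> 'l" where
  "pair_coeff \<iota> \<Sigma> \<psi> \<beta> j =
     of_nat (semichar_binomial \<Sigma> \<psi> \<beta>) * unit_power_sum \<iota> (semichar_degree \<Sigma> \<beta>) j"

lemma pair_coeff_in_prime_field:
  fixes \<iota> :: "'f::finite_field \<Rightarrow> 'l::field"
  assumes "field_embedding \<iota>"
  shows "pair_coeff \<iota> \<Sigma> \<psi> \<beta> j \<in> prime_field"
proof -
  have "of_int (int k) \<in> (prime_field :: 'l set)" for k
    by (rule of_int_in_prime_field[OF field_embedding_CHAR_pos[OF assms]])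
  then show ?thesis unfolding pair_coeff_def
    by (intro prime_field_mult unit_power_sum_in_prime_field field_embedding_CHAR_pos[OF assms] assms)
      simp
qed

text \<open>For \<open>b = a - e c\<close> the difference \<open>\<gamma> a - \<gamma> b\<close> is
  \<open>\<iota> e * \<gamma> c\<close>, so each expanded term is a factor in \<open>e\<close> times
  a factor in \<open>a\<close> and \<open>c\<close>. Summing the former over \<open>e\<close> gives
  \<open>pair_coeff\<close>; summing the latter gives a power sum of length two.\<close>

lemma sum_distinct_pairs:
  fixes \<iota> :: "'f::finite_field \<Rightarrow> 'l::field"
  assumes emb: "field_embedding \<iota>" and \<Sigma>: "finite \<Sigma>"
    and \<delta>: "\<And>i. i \<in> \<Sigma> \<Longrightarrow> inj_Fq_linear \<iota> (\<delta> i)"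
    and \<gamma>: "inj_Fq_linear \<iota> \<gamma>"
    and \<sigma>: "\<sigma> \<in> semichars \<Sigma>" and \<psi>: "\<psi> \<in> semichars \<Sigma>"
  shows "(\<Sum>a\<in>monic_deg d. \<Sum>b\<in>monic_deg d - {a}.
      semichar_eval \<Sigma> \<delta> \<sigma> a * semichar_eval \<Sigma> \<delta> \<psi> b / (\<gamma> a ^ i * (\<gamma> a - \<gamma> b) ^ j)) =
    (\<Sum>(\<alpha>, \<beta>)\<in>semichar_factorizations \<Sigma> (\<sigma> + \<psi>).
      pair_coeff \<iota> \<Sigma> \<psi> \<beta> j * power_sum \<Sigma> \<delta> \<gamma> d [(\<alpha>, i), (\<beta>, j)])"
proof -
  let ?X = "semichar_factorizations \<Sigma> (\<sigma> + \<psi>)"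
  let ?s = "semichar_eval \<Sigma> \<delta>"
  let ?w = "\<lambda>\<alpha> \<beta> a c. ?s \<alpha> a * ?s \<beta> c / (\<gamma> a ^ i * \<gamma> c ^ j)"
  have expand: "?s \<sigma> a * ?s \<psi> (a - smult e c) =
    (\<Sum>(\<alpha>, \<beta>)\<in>?X. of_nat (semichar_binomial \<Sigma> \<psi> \<beta>) * \<iota> (- e) ^ semichar_degree \<Sigma> \<beta> *
      ?s \<alpha> a * ?s \<beta> c)" for a e c
    using emb \<Sigma> \<delta> \<sigma> \<psi> by (rule semichar_eval_diff_smult)
  have inner: "(\<Sum>e\<in>UNIV - {0}. ?s \<sigma> a * ?s \<psi> (a - smult e c) /
      (\<gamma> a ^ i * (\<gamma> a - \<gamma> (a - smult e c)) ^ j)) =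
    (\<Sum>(\<alpha>, \<beta>)\<in>?X. pair_coeff \<iota> \<Sigma> \<psi> \<beta> j * ?w \<alpha> \<beta> a c)" for a c
  proof -
    have "(\<Sum>e\<in>UNIV - {0}. ?s \<sigma> a * ?s \<psi> (a - smult e c) /
        (\<gamma> a ^ i * (\<gamma> a - \<gamma> (a - smult e c)) ^ j)) =
      (\<Sum>e\<in>UNIV - {0}. \<Sum>(\<alpha>, \<beta>)\<in>?X. of_nat (semichar_binomial \<Sigma> \<psi> \<beta>) *
        (\<iota> (- e) ^ semichar_degree \<Sigma> \<beta> / \<iota> e ^ j) * ?w \<alpha> \<beta> a c)"
      unfolding expand sum_divide_distrib
      by (intro sum.cong refl)
        (auto simp: inj_Fq_linear_diff[OF \<gamma>] inj_Fq_linear_smult[OF \<gamma>] power_mult_distrib mult_ac)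
    also have "\<dots> = (\<Sum>(\<alpha>, \<beta>)\<in>?X. pair_coeff \<iota> \<Sigma> \<psi> \<beta> j * ?w \<alpha> \<beta> a c)"
      unfolding case_prod_unfold
      by (subst sum.swap)
        (simp only: pair_coeff_def unit_power_sum_def sum_distrib_left sum_distrib_right)
    finally show ?thesis .
  qed
  have "(\<Sum>a\<in>monic_deg d. \<Sum>b\<in>monic_deg d - {a}.
      ?s \<sigma> a * ?s \<psi> b / (\<gamma> a ^ i * (\<gamma> a - \<gamma> b) ^ j)) =
    (\<Sum>a\<in>monic_deg d. \<Sum>c\<in>monic_below d. \<Sum>(\<alpha>, \<beta>)\<in>?X. pair_coeff \<iota> \<Sigma> \<psi> \<beta> j * ?w \<alpha> \<beta> a c)"
    by (rule sum.cong[OF refl]) (simp only: sum_monic_deg_diff inner)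
  also have "\<dots> = (\<Sum>a\<in>monic_deg d. \<Sum>(\<alpha>, \<beta>)\<in>?X. \<Sum>c\<in>monic_below d. pair_coeff \<iota> \<Sigma> \<psi> \<beta> j * ?w \<alpha> \<beta> a c)"
    unfolding case_prod_unfold by (rule sum.cong[OF refl], rule sum.swap)
  also have "\<dots> = (\<Sum>(\<alpha>, \<beta>)\<in>?X. \<Sum>a\<in>monic_deg d. \<Sum>c\<in>monic_below d. pair_coeff \<iota> \<Sigma> \<psi> \<beta> j * ?w \<alpha> \<beta> a c)"
    unfolding case_prod_unfold by (rule sum.swap)
  also have "\<dots> = (\<Sum>(\<alpha>, \<beta>)\<in>?X. pair_coeff \<iota> \<Sigma> \<psi> \<beta> j * power_sum \<Sigma> \<delta> \<gamma> d [(\<alpha>, i), (\<beta>, j)])"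
    by (simp only: power_sum_pair sum_distrib_left)
  finally show ?thesis .
qed

section \<open>Double sums over off-diagonal pairs\<close>

lemma sum_off_diagonal:
  fixes F :: "'a \<Rightarrow> 'a \<Rightarrow> 'b::ab_group_add"
  assumes "finite M"
  shows "(\<Sum>a\<in>M. \<Sum>b\<in>M. F a b) - (\<Sum>a\<in>M. F a a) = (\<Sum>a\<in>M. \<Sum>b\<in>M - {a}. F a b)"
  unfolding sum_subtractf[symmetric] using assms
  by (intro sum.cong refl) (simp add: sum.remove)

text \<open>The set of pairs of distinct elements is symmetric. The exchange brings the partial
  fractions with powers of \<open>\<gamma> b\<close> to the form treated by
  \<open>sum_distinct_pairs\<close>.\<close>

lemma sum_off_diagonal_swap:
  assumes "finite M"
  shows "(\<Sum>a\<in>M. \<Sum>b\<in>M - {a}. F a b) = (\<Sum>a\<in>M. \<Sum>b\<in>M - {a}. F b a)"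
proof -
  have "(\<Sum>a\<in>M. \<Sum>b\<in>M - {a}. F a b) = (\<Sum>(a, b)\<in>(SIGMA a:M. M - {a}). F a b)"
    using assms by (simp add: sum.Sigma)
  also have "\<dots> = (\<Sum>(a, b)\<in>(SIGMA a:M. M - {a}). F b a)"
    by (rule sum.reindex_bij_witness[of _ prod.swap prod.swap]) auto
  also have "\<dots> = (\<Sum>a\<in>M. \<Sum>b\<in>M - {a}. F b a)"
    using assms by (simp add: sum.Sigma)
  finally show ?thesis .
qed

section \<open>Expansion of the product of two power sums\<close>

theorem theorem9p2:
  fixes \<iota> :: "'f::finite_field \<Rightarrow> 'l::field"
    and \<Sigma> :: "nat set"
    and \<delta> :: "nat \<Rightarrow> 'f poly \<Rightarrow> 'l"
    and \<gamma> :: "'f poly \<Rightarrow> 'l"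
    and \<sigma> \<psi> :: "nat \<Rightarrow>\<^sub>0 nat"
    and m n :: nat
  assumes "field_embedding \<iota>"
    and "finite \<Sigma>" and "0 \<notin> \<Sigma>"
    and "\<And>i. i \<in> \<Sigma> \<Longrightarrow> inj_Fq_linear \<iota> (\<delta> i)"
    and "inj_Fq_linear \<iota> \<gamma>"
    and "\<sigma> \<in> semichars \<Sigma>" and "\<psi> \<in> semichars \<Sigma>"
    and "m \<ge> 1" and "n \<ge> 1"
  shows "\<exists>f :: (nat \<Rightarrow>\<^sub>0 nat) \<Rightarrow> (nat \<Rightarrow>\<^sub>0 nat) \<Rightarrow> nat \<Rightarrow> nat \<Rightarrow> 'l.
    (\<forall>(\<alpha>, \<beta>) \<in> semichar_factorizations \<Sigma> (\<sigma> + \<psi>).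
       \<forall>(i, j) \<in> exponent_splittings (m + n). f \<alpha> \<beta> i j \<in> prime_field) \<and>
    (\<forall>d. power_sum \<Sigma> \<delta> \<gamma> d [(\<sigma>, m)] * power_sum \<Sigma> \<delta> \<gamma> d [(\<psi>, n)]
          - power_sum \<Sigma> \<delta> \<gamma> d [(\<sigma> + \<psi>, m + n)] =
       (\<Sum>(\<alpha>, \<beta>) \<in> semichar_factorizations \<Sigma> (\<sigma> + \<psi>).
          \<Sum>(i, j) \<in> exponent_splittings (m + n).
            f \<alpha> \<beta> i j * power_sum \<Sigma> \<delta> \<gamma> d [(\<alpha>, i), (\<beta>, j)]))"
proof -
  note emb = assms(1) and \<gamma> = assms(5)
  obtain P Q :: "nat \<Rightarrow> int" where PQ: "\<And>x y :: 'l. x \<noteq> 0 \<Longrightarrow> y \<noteq> 0 \<Longrightarrow> x \<noteq> y \<Longrightarrow>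
      1 / (x ^ m * y ^ n) = (\<Sum>(i, j)\<in>exponent_splittings (m + n).
        of_int (P i) / (x ^ i * (x - y) ^ j) + of_int (Q i) / (y ^ i * (x - y) ^ j))"
    using partial_fractions[OF assms(8,9), where ?'a = 'l] by blast
  \<comment> \<open>The \<open>P\<close> terms carry powers of \<open>\<gamma> a\<close> and expand
    \<open>\<psi>\<close>; the \<open>Q\<close> terms carry powers of \<open>\<gamma> b\<close>, so
    the roles are exchanged and \<open>\<sigma>\<close> is expanded. The sign accounts for replacing
    \<open>(\<gamma> a - \<gamma> b) ^ j\<close> by
    \<open>(\<gamma> b - \<gamma> a) ^ j\<close>.\<close>
  define f :: "(nat \<Rightarrow>\<^sub>0 nat) \<Rightarrow> (nat \<Rightarrow>\<^sub>0 nat) \<Rightarrow> nat \<Rightarrow> nat \<Rightarrow> 'l" where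
    "f \<alpha> \<beta> i j = of_int (P i) * pair_coeff \<iota> \<Sigma> \<psi> \<beta> j
      + of_int (Q i * (- 1) ^ j) * pair_coeff \<iota> \<Sigma> \<sigma> \<beta> j" for \<alpha> \<beta> i j
  have "f \<alpha> \<beta> i j \<in> prime_field" for \<alpha> \<beta> i j
    unfolding f_def using field_embedding_CHAR_pos[OF emb]
    by (intro prime_field_add prime_field_mult of_int_in_prime_field pair_coeff_in_prime_field emb)
  moreover have "power_sum \<Sigma> \<delta> \<gamma> d [(\<sigma>, m)] * power_sum \<Sigma> \<delta> \<gamma> d [(\<psi>, n)]
          - power_sum \<Sigma> \<delta> \<gamma> d [(\<sigma> + \<psi>, m + n)] =
       (\<Sum>(\<alpha>, \<beta>) \<in> semichar_factorizations \<Sigma> (\<sigma> + \<psi>).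
          \<Sum>(i, j) \<in> exponent_splittings (m + n).
            f \<alpha> \<beta> i j * power_sum \<Sigma> \<delta> \<gamma> d [(\<alpha>, i), (\<beta>, j)])" for d
  proof -
    let ?s = "semichar_eval \<Sigma> \<delta>"
    let ?M = "monic_deg d :: 'f poly set"
    let ?I = "exponent_splittings (m + n)"
    let ?X = "semichar_factorizations \<Sigma> (\<sigma> + \<psi>)"
    let ?T = "\<lambda>\<alpha> i \<beta> j. power_sum \<Sigma> \<delta> \<gamma> d [(\<alpha>, i), (\<beta>, j)]"
    let ?A = "\<lambda>i j a b. ?s \<sigma> a * ?s \<psi> b / (\<gamma> a ^ i * (\<gamma> a - \<gamma> b) ^ j)"
    let ?B = "\<lambda>i j a b. ?s \<psi> b * ?s \<sigma> a / (\<gamma> b ^ i * (\<gamma> b - \<gamma> a) ^ j)"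
    note M = finite_monic_deg[of d, where ?'f = 'f]
    have A: "(\<Sum>a\<in>?M. \<Sum>b\<in>?M - {a}. ?A i j a b) =
        (\<Sum>(\<alpha>, \<beta>)\<in>?X. pair_coeff \<iota> \<Sigma> \<psi> \<beta> j * ?T \<alpha> i \<beta> j)" for i j
      using assms by (intro sum_distinct_pairs)
    \<comment> \<open>After the exchange of \<open>a\<close> and \<open>b\<close> this is the sum
      over distinct pairs with \<open>\<sigma>\<close> and \<open>\<psi>\<close> swapped; the set of
      factorizations depends only on their product.\<close>
    have B: "(\<Sum>a\<in>?M. \<Sum>b\<in>?M - {a}. ?B i j a b) =
        (\<Sum>(\<alpha>, \<beta>)\<in>?X. pair_coeff \<iota> \<Sigma> \<sigma> \<beta> j * ?T \<alpha> i \<beta> j)" for i j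
      unfolding sum_off_diagonal_swap[OF M, of "?B i j"] add.commute[of \<sigma> \<psi>]
      using assms by (intro sum_distinct_pairs)
    have split: "?s \<sigma> a * ?s \<psi> b / (\<gamma> a ^ m * \<gamma> b ^ n) =
        (\<Sum>(i, j)\<in>?I. of_int (P i) * ?A i j a b + of_int (Q i * (- 1) ^ j) * ?B i j a b)"
      if "a \<in> ?M" "b \<in> ?M - {a}" for a b
    proof -
      have ab: "a \<noteq> 0" "b \<noteq> 0" "a \<noteq> b" using that by (auto simp: monic_deg_def)
      have "?s \<sigma> a * ?s \<psi> b / (\<gamma> a ^ m * \<gamma> b ^ n) =
          ?s \<sigma> a * ?s \<psi> b * (1 / (\<gamma> a ^ m * \<gamma> b ^ n))" by simp
      also have "1 / (\<gamma> a ^ m * \<gamma> b ^ n) = (\<Sum>(i, j)\<in>?I.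
          of_int (P i) / (\<gamma> a ^ i * (\<gamma> a - \<gamma> b) ^ j) + of_int (Q i) / (\<gamma> b ^ i * (\<gamma> a - \<gamma> b) ^ j))"
        using ab inj_Fq_linear_nonzero[OF \<gamma>] inj_Fq_linear_eq_iff[OF \<gamma>] by (intro PQ) auto
      also have "?s \<sigma> a * ?s \<psi> b * \<dots> =
          (\<Sum>(i, j)\<in>?I. of_int (P i) * ?A i j a b + of_int (Q i * (- 1) ^ j) * ?B i j a b)"
        unfolding sum_distrib_left
      proof (intro sum.cong refl, clarify)
        fix i j
        have "(\<gamma> b - \<gamma> a) ^ j = (- 1) ^ j * (\<gamma> a - \<gamma> b) ^ j"
          using power_minus[of "\<gamma> a - \<gamma> b" j] by simp
        moreover have "(- 1) ^ j / ((- 1) ^ j * z) = 1 / z" for z :: 'l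
          by simp
        ultimately have sign: "(- 1) ^ j / (\<gamma> b - \<gamma> a) ^ j = 1 / (\<gamma> a - \<gamma> b) ^ j" by metis
        have "of_int (Q i * (- 1) ^ j) * ?B i j a b =
            of_int (Q i) * (?s \<sigma> a * ?s \<psi> b / \<gamma> b ^ i) * ((- 1) ^ j / (\<gamma> b - \<gamma> a) ^ j)"
          by (simp add: mult_ac)
        also have "\<dots> = of_int (Q i) * (?s \<sigma> a * ?s \<psi> b / (\<gamma> b ^ i * (\<gamma> a - \<gamma> b) ^ j))"
          unfolding sign by simp
        finally have B': "of_int (Q i * (- 1) ^ j) * ?B i j a b = \<dots>" .
        show "?s \<sigma> a * ?s \<psi> b * (of_int (P i) / (\<gamma> a ^ i * (\<gamma> a - \<gamma> b) ^ j)
            + of_int (Q i) / (\<gamma> b ^ i * (\<gamma> a - \<gamma> b) ^ j)) =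
            of_int (P i) * ?A i j a b + of_int (Q i * (- 1) ^ j) * ?B i j a b"
          unfolding B' by (simp only: distrib_left times_divide_eq_right mult_ac)
      qed
      finally show ?thesis .
    qed
    \<comment> \<open>The diagonal \<open>a = b\<close> of the product of the two sums is exactly
      the subtracted power sum of \<open>\<sigma> + \<psi>\<close>.\<close>
    have "power_sum \<Sigma> \<delta> \<gamma> d [(\<sigma>, m)] * power_sum \<Sigma> \<delta> \<gamma> d [(\<psi>, n)]
        - power_sum \<Sigma> \<delta> \<gamma> d [(\<sigma> + \<psi>, m + n)] =
      (\<Sum>a\<in>?M. \<Sum>b\<in>?M - {a}. ?s \<sigma> a * ?s \<psi> b / (\<gamma> a ^ m * \<gamma> b ^ n))"
      unfolding sum_off_diagonal[OF M, symmetric] power_sum_single sum_product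
      by (simp add: semichar_eval_add power_add)
    also have "\<dots> = (\<Sum>a\<in>?M. \<Sum>b\<in>?M - {a}. \<Sum>(i, j)\<in>?I.
        of_int (P i) * ?A i j a b + of_int (Q i * (- 1) ^ j) * ?B i j a b)"
      by (intro sum.cong refl split)
    \<comment> \<open>The pair \<open>(i, j)\<close> is moved outermost, so that \<open>A\<close>
      and \<open>B\<close> apply for each fixed pair of exponents.\<close>
    also have "\<dots> = (\<Sum>a\<in>?M. \<Sum>(i, j)\<in>?I. \<Sum>b\<in>?M - {a}.
        of_int (P i) * ?A i j a b + of_int (Q i * (- 1) ^ j) * ?B i j a b)"
      unfolding case_prod_unfold by (rule sum.cong[OF refl], rule sum.swap)
    also have "\<dots> = (\<Sum>(i, j)\<in>?I. \<Sum>a\<in>?M. \<Sum>b\<in>?M - {a}.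
        of_int (P i) * ?A i j a b + of_int (Q i * (- 1) ^ j) * ?B i j a b)"
      unfolding case_prod_unfold by (rule sum.swap)
    also have "\<dots> = (\<Sum>(i, j)\<in>?I. of_int (P i) * (\<Sum>a\<in>?M. \<Sum>b\<in>?M - {a}. ?A i j a b)
        + of_int (Q i * (- 1) ^ j) * (\<Sum>a\<in>?M. \<Sum>b\<in>?M - {a}. ?B i j a b))"
      by (simp only: sum.distrib sum_distrib_left)
    also have "\<dots> = (\<Sum>(i, j)\<in>?I. \<Sum>(\<alpha>, \<beta>)\<in>?X. f \<alpha> \<beta> i j * ?T \<alpha> i \<beta> j)"
      unfolding A B f_def case_prod_unfold distrib_right sum.distrib sum_distrib_left mult.assoc ..
    also have "\<dots> = (\<Sum>(\<alpha>, \<beta>)\<in>?X. \<Sum>(i, j)\<in>?I. f \<alpha> \<beta> i j * ?T \<alpha> i \<beta> j)"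
      unfolding case_prod_unfold by (rule sum.swap)
    finally show ?thesis .
  qed
  ultimately show ?thesis by blast
qed

end
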